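(* There exists an LDQL query that cannot be expressed as a PP-based SPARQL query under context-based semantics; that is, there exists an LDQL query $q$ for which there are no PP-based SPARQL query $R$ and finite set $S\subseteq\mathcal U$ such that $[\![R]\!]^{\mathsf{ctxt}}_{W}=[\![q]\!]^{S}_{W}$ for every Web of Linked Data $W$.
   Context: **Data model.** $\mathcal U$ (URIs), $\mathcal B$ (blank nodes), $\mathcal L$ (literals), $\mathcal V$ (variables, written $?v,?x,\dots$) and $\mathcal D$ (documents) are pairwise disjoint infinite sets. An RDF triple is an element of $\mathcal T=(\mathcal U\cup\mathcal B)\times\mathcal U\times(\mathcal U\cup\mathcal B\cup\mathcal L)$; $\mathrm{uris}(t)$ is the set of URIs in the triple $t$. Each document $d$ carries a finite set of triples $\mathrm{data}(d)\subseteq\mathcal T$, distinct documents using disjoint sets of blank nodes. A Web of Linked Data is $W=\langle D,adoc\rangle$ with $D\subseteq\mathcal D$ finite and $adoc:\mathcal U\to D$ a partial surjective function with domain $\mathrm{dom}(adoc)$. When quantifying over all Webs, the assignment $\mathrm{data}$ also varies over all possibilities. The link graph $\mathcal G_W$ has node set $D$ and edges $\langle d,(t,u),d'\rangle$ for all $d\in D$, $t\in\mathrm{data}(d)$, $u\in\mathrm{uris}(t)\cap\mathrm{dom}(adoc)$, $d'=adoc(u)$. **SPARQL.** A solution mapping $\mu$ is a partial function with finite domain from $\mathcal V$ to $\mathcal U\cup\mathcal B\cup\mathcal L$; $\mu[\alpha]=\mu(\alpha)$ if $\alpha\in\mathrm{dom}(\mu)$, else $\mu[\alpha]=\alpha$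 (extended componentwise to triples). $\mu,\mu'$ are compatible if they agree on $\mathrm{dom}(\mu)\cap\mathrm{dom}(\mu')$. $\Omega_1\Join\Omega_2=\{\mu_1\cup\mu_2\mid\mu_i\in\Omega_i\text{ compatible}\}$. An RDF dataset $\mathfrak D$ consists of a default graph and finitely or infinitely many named graphs $\langle u,G_u\rangle$ with pairwise distinct names $u\in\mathcal U$. Graph patterns: finite sets $B$ of triple patterns from $(\mathcal U\cup\mathcal L\cup\mathcal V)\times(\mathcal U\cup\mathcal V)\times(\mathcal U\cup\mathcal L\cup\mathcal V)$ (basic graph patterns, possibly the empty one $\{\,\}$; a triple pattern is identified with a singleton), and $(P_1\,\mathsf{AND}\,P_2)$, $(P_1\,\mathsf{UNION}\,P_2)$, $(P_1\,\mathsf{OPT}\,P_2)$, $(P_1\,\mathsf{FILTER}\,R)$, $(\mathsf{GRAPH}\ c\ P_1)$ with $c\in\mathcal U\cup\mathcal V$, $(P_1\,\mathsf{BIND}(e\,\mathsf{AS}\,?v))$ with $e\in\mathcal U\cup\mathcal L\cup\mathcal V$ and $?v$ not occurring in $P_1$. Filter conditions are Boolean combinations of $\mathrm{bound}(?x)$, $?x=c$, $?x=?y$ (atoms with an unbound variable are false). Evaluation $[\![P]\!]^{\mathfrak D}_G$: $[\![B]\!]=\{\mu\mid\mathrm{dom}(\mu)=\mathrm{var}(B),\mu[B]\subseteq G\}$; $\mathsf{AND}$ is $\Join$; $\mathsf{UNION}$ is $\cup$; $\mathsf{OPT}$ gives $(\Omega_1\Join\Omega_2)\cup\{\mu\in\Omega_1\mid\text{no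 }\mu'\in\Omega_2\text{ compatible with }\mu\}$; $\mathsf{FILTER}$ selects the mappings satisfying $R$; $[\![\mathsf{GRAPH}\ u\ P_1]\!]^{\mathfrak D}_G=[\![P_1]\!]^{\mathfrak D}_{G_u}$ ($G_u=\emptyset$ if $u$ is not a name in $\mathfrak D$); $[\![\mathsf{GRAPH}\ ?x\ P_1]\!]^{\mathfrak D}_G=\bigcup_{u\text{ name in }\mathfrak D}([\![P_1]\!]^{\mathfrak D}_{G_u}\Join\{\{?x\mapsto u\}\})$; $\mathsf{BIND}$ extends each mapping $\mu$ by $?v\mapsto\mu[e]$ (leaving $\mu$ unchanged if $e$ is an unbound variable). **LDQL.** A link pattern is a tuple in $(\mathcal U\cup\{\_,+\})\times(\mathcal U\cup\{\_,+\})\times(\mathcal U\cup\mathcal L\cup\{\_,+\})$. An edge with label $(\langle x_1,x_2,x_3\rangle,u)$ matches $\langle y_1,y_2,y_3\rangle$ in the context of URI $u_c$ if (1) some $i$ has $y_i=\_$ and $x_i=u$, and (2) for each $i$: $y_i=+$ and $x_i=u_c$, or $y_i=x_i$, or $y_i=\_$. LDQL queries $q$ and link path expressions (LPEs) $lpe$ are given by $q:=\langle lpe,P\rangle\mid(\mathsf{SEED}\ U\ q)\mid(\mathsf{SEED}\ ?v\ q)\mid(q\,\mathsf{AND}\,q)\mid(q\,\mathsf{UNION}\,q)\mid\pi_Vq$, $lpe:=\varepsilon\mid lp\mid lpe/lpe\mid lpe|lpe\mid lpe^*\mid[lpe]\mid\langle ?v,q\rangle$, with $lp$ a link pattern, $P$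 a graph pattern, $U$ a finite set of URIs, $V$ a finite set of variables. $\mathrm{dataset}_W(U)$ is the dataset with default graph $\bigcup_{u\in U\cap\mathrm{dom}(adoc)}\mathrm{data}(adoc(u))$ and named graphs $\langle u,\mathrm{data}(adoc(u))\rangle$ for $u\in U\cap\mathrm{dom}(adoc)$. For finite $S\subseteq\mathcal U$: $[\![\langle lpe,P\rangle]\!]^S_W=[\![P]\!]^{\mathfrak D}_G$ with $\mathfrak D=\mathrm{dataset}_W(\bigcup_{u\in S}[\![lpe]\!]^u_W)$ and $G$ its default graph; $[\![(\mathsf{SEED}\ U\ q)]\!]^S_W=[\![q]\!]^U_W$; $[\![(\mathsf{SEED}\ ?v\ q)]\!]^S_W=\bigcup_{u\in\mathcal U}([\![q]\!]^{\{u\}}_W\Join\{\{?v\mapsto u\}\})$; $\mathsf{UNION}$ is $\cup$; $\mathsf{AND}$ is $\Join$; $[\![\pi_Vq]\!]^S_W$ consists of the restrictions of the mappings in $[\![q]\!]^S_W$ to $V$. For $u_c\in\mathrm{dom}(adoc)$: $[\![\varepsilon]\!]^{u_c}_W=\{u_c\}$; $[\![lp]\!]^{u_c}_W$ is the set of URIs $u$ such that some edge $\langle adoc(u_c),(t,u),d'\rangle\in\mathcal G_W$ matches $lp$ in the context of $u_c$; $[\![l_1/l_2]\!]^{u_c}_W=\bigcup_{u'\in[\![l_1]\!]^{u_c}_W}[\![l_2]\!]^{u'}_W$; $[\![l_1|l_2]\!]^{u_c}_W$ is the union; $[\![l^*]\!]^{u_c}_W=\{u_c\}\cup[\![l]\!]^{u_c}_W\cup[\![l/l]\!]^{u_c}_W\cup\cdots$;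 $[\![[l]]\!]^{u_c}_W=\{u_c\}$ if $[\![l]\!]^{u_c}_W\ne\emptyset$, else $\emptyset$; $[\![\langle ?v,q\rangle]\!]^{u_c}_W=\{u\in\mathcal U\mid\mu(?v)=u\text{ for some }\mu\in[\![q]\!]^{\{u_c\}}_W\}$. If $u_c\notin\mathrm{dom}(adoc)$ then $[\![lpe]\!]^{u_c}_W=\emptyset$. **Property paths under context-based semantics.** PP expressions: $pe:=p\mid\,!(u_1|\cdots|u_k)\mid pe/pe\mid pe|pe\mid pe^*$ with $p,u_1,\dots,u_k\in\mathcal U$. A PP-pattern is $\langle\alpha,pe,\beta\rangle$ with $\alpha,\beta\in\mathcal U\cup\mathcal L\cup\mathcal V$. Put $C^W(u)=\{\langle s,p,o\rangle\in\mathrm{data}(adoc(u))\mid s=u\}$ for $u\in\mathrm{dom}(adoc)$ and $C^W(a)=\emptyset$ for every other RDF term $a$. $\mathit{terms}(W)$ is the set of all URIs, blank nodes and literals occurring in triples of $\mathrm{data}(d)$, $d\in D$. Then - $[\![\langle\alpha,p,\beta\rangle]\!]^{\mathsf{ctxt}}_W=\{\mu\mid\mathrm{dom}(\mu)=\{\alpha,\beta\}\cap\mathcal V,\ \mu[\langle\alpha,p,\beta\rangle]\in C^W(\mu[\alpha])\}$; - $[\![\langle\alpha,!(u_1|\cdots|u_k),\beta\rangle]\!]^{\mathsf{ctxt}}_W=\{\mu\mid\mathrm{dom}(\mu)=\{\alpha,\beta\}\cap\mathcal V,\ \exists p\notin\{u_1,\dots,u_k\}:\mu[\langle\alpha,p,\beta\rangle]\in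 C^W(\mu[\alpha])\}$; - $[\![\langle\alpha,pe_1/pe_2,\beta\rangle]\!]^{\mathsf{ctxt}}_W=\pi_{\{\alpha,\beta\}\cap\mathcal V}([\![\langle\alpha,pe_1,?v\rangle]\!]^{\mathsf{ctxt}}_W\Join[\![\langle ?v,pe_2,\beta\rangle]\!]^{\mathsf{ctxt}}_W)$ with $?v$ fresh; - $|$ is union; - $[\![\langle\alpha,pe^*,\beta\rangle]\!]^{\mathsf{ctxt}}_W=\{\mu\mid\mathrm{dom}(\mu)=\{\alpha,\beta\}\cap\mathcal V,\ \mu[\alpha]=\mu[\beta]\in\mathit{terms}(W)\}\cup[\![\langle\alpha,pe,\beta\rangle]\!]^{\mathsf{ctxt}}_W\cup[\![\langle\alpha,pe/pe,\beta\rangle]\!]^{\mathsf{ctxt}}_W\cup\cdots$. A PP-based SPARQL query is built from PP-patterns using the SPARQL operators $\mathsf{AND},\mathsf{UNION},\mathsf{OPT},\mathsf{FILTER},\mathsf{BIND}$, and $[\![\cdot]\!]^{\mathsf{ctxt}}_W$ is extended to these operators by their standard semantics given above. *)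

theory Defs
  imports Main "HOL-Library.Infinite_Typeclass"
begin

text \<open>
  The pairwise disjoint infinite sets of URIs, blank nodes, literals, variables and documents are
  the types \<open>'u\<close>, \<open>'b\<close>, \<open>'l\<close>, \<open>'v\<close> and \<open>'d\<close>, which theorems assume to be of class \<open>infinite\<close>.
\<close>

datatype ('u, 'b, 'l) rdf_term = Uri 'u | Blank 'b | Lit 'l

type_synonym ('u, 'b, 'l) triple =
  "('u, 'b, 'l) rdf_term \<times> ('u, 'b, 'l) rdf_term \<times> ('u, 'b, 'l) rdf_term"

definition rdf_triples :: "('u, 'b, 'l) triple set" where
  "rdf_triples = (range Uri \<union> range Blank) \<times> range Uri \<times> UNIV"

fun triple_terms :: "('u, 'b, 'l) triple \<Rightarrow> ('u, 'b, 'l) rdf_term set" where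
  "triple_terms (s, p, o') = {s, p, o'}"

definition uris :: "('u, 'b, 'l) triple \<Rightarrow> 'u set" where
  "uris t = {u. Uri u \<in> triple_terms t}"

definition blanks :: "('u, 'b, 'l) triple set \<Rightarrow> 'b set" where
  "blanks G = {b. \<exists>t\<in>G. Blank b \<in> triple_terms t}"

text \<open>
  The assignment \<open>data\<close> is a component of the record, so that quantifying over Webs also
  quantifies over \<open>data\<close>.
\<close>

record ('u, 'b, 'l, 'd) web =
  docs :: "'d set"
  adoc :: "'u \<rightharpoonup> 'd"
  data :: "'d \<Rightarrow> ('u, 'b, 'l) triple set"

definition is_web :: "('u, 'b, 'l, 'd) web \<Rightarrow> bool" where
  "is_web W \<longleftrightarrow>
     finite (docs W) \<and> ran (adoc W) = docs W \<and>
     (\<forall>d. finite (data W d) \<and> data W d \<subseteq> rdf_triples) \<and>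
     (\<forall>d d'. d \<noteq> d' \<longrightarrow> blanks (data W d) \<inter> blanks (data W d') = {})"

definition link_graph ::
    "('u, 'b, 'l, 'd) web \<Rightarrow> ('d \<times> (('u, 'b, 'l) triple \<times> 'u) \<times> 'd) set" where
  "link_graph W =
     {(d, (t, u), d'). d \<in> docs W \<and> t \<in> data W d \<and> u \<in> uris t \<and> adoc W u = Some d'}"

definition terms :: "('u, 'b, 'l, 'd) web \<Rightarrow> ('u, 'b, 'l) rdf_term set" where
  "terms W = (\<Union>d\<in>docs W. \<Union>t\<in>data W d. triple_terms t)"

type_synonym ('u, 'b, 'l, 'v) mapping = "'v \<rightharpoonup> ('u, 'b, 'l) rdf_term"

datatype ('u, 'l, 'v) pterm = PUri 'u | PLit 'l | PVar 'v

type_synonym ('u, 'l, 'v) triple_pattern =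
  "('u, 'l, 'v) pterm \<times> ('u, 'l, 'v) pterm \<times> ('u, 'l, 'v) pterm"

fun pterm_vars :: "('u, 'l, 'v) pterm \<Rightarrow> 'v set" where
  "pterm_vars (PVar x) = {x}"
| "pterm_vars _ = {}"

fun tp_vars :: "('u, 'l, 'v) triple_pattern \<Rightarrow> 'v set" where
  "tp_vars (a, p, b) = pterm_vars a \<union> pterm_vars p \<union> pterm_vars b"

text \<open>
  \<open>inst \<mu> \<alpha>\<close> is \<open>\<mu>[\<alpha>]\<close>. The result \<open>None\<close> stands for the case that \<open>\<alpha>\<close> is a variable
  outside the domain of \<open>\<mu>\<close>, where \<open>\<mu>[\<alpha>] = \<alpha>\<close> is not an RDF term.
\<close>

fun inst :: "('u, 'b, 'l, 'v) mapping \<Rightarrow> ('u, 'l, 'v) pterm \<rightharpoonup> ('u, 'b, 'l) rdf_term" where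
  "inst \<mu> (PUri u) = Some (Uri u)"
| "inst \<mu> (PLit l) = Some (Lit l)"
| "inst \<mu> (PVar x) = \<mu> x"

text \<open>\<open>inst_in \<mu> tp G\<close> is \<open>\<mu>[tp] \<in> G\<close>.\<close>

fun inst_in ::
    "('u, 'b, 'l, 'v) mapping \<Rightarrow> ('u, 'l, 'v) triple_pattern \<Rightarrow> ('u, 'b, 'l) triple set \<Rightarrow> bool" where
  "inst_in \<mu> (a, p, b) G \<longleftrightarrow>
     (\<exists>s p' o'. inst \<mu> a = Some s \<and> inst \<mu> p = Some p' \<and> inst \<mu> b = Some o' \<and> (s, p', o') \<in> G)"

definition compatible ::
    "('u, 'b, 'l, 'v) mapping \<Rightarrow> ('u, 'b, 'l, 'v) mapping \<Rightarrow> bool" where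
  "compatible \<mu> \<mu>' \<longleftrightarrow> (\<forall>x \<in> dom \<mu> \<inter> dom \<mu>'. \<mu> x = \<mu>' x)"

definition join ::
    "('u, 'b, 'l, 'v) mapping set \<Rightarrow> ('u, 'b, 'l, 'v) mapping set \<Rightarrow> ('u, 'b, 'l, 'v) mapping set"
  where
  "join \<Omega>1 \<Omega>2 = {\<mu>1 ++ \<mu>2 | \<mu>1 \<mu>2. \<mu>1 \<in> \<Omega>1 \<and> \<mu>2 \<in> \<Omega>2 \<and> compatible \<mu>1 \<mu>2}"

definition left_join ::
    "('u, 'b, 'l, 'v) mapping set \<Rightarrow> ('u, 'b, 'l, 'v) mapping set \<Rightarrow> ('u, 'b, 'l, 'v) mapping set"
  where
  "left_join \<Omega>1 \<Omega>2 = join \<Omega>1 \<Omega>2 \<union> {\<mu> \<in> \<Omega>1. \<not> (\<exists>\<mu>' \<in> \<Omega>2. compatible \<mu> \<mu>')}"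

definition proj ::
    "'v set \<Rightarrow> ('u, 'b, 'l, 'v) mapping set \<Rightarrow> ('u, 'b, 'l, 'v) mapping set" where
  "proj V \<Omega> = (\<lambda>\<mu>. \<mu> |` V) ` \<Omega>"

definition bind_ext ::
    "('u, 'l, 'v) pterm \<Rightarrow> 'v \<Rightarrow> ('u, 'b, 'l, 'v) mapping \<Rightarrow> ('u, 'b, 'l, 'v) mapping" where
  "bind_ext e v \<mu> = (case inst \<mu> e of None \<Rightarrow> \<mu> | Some t \<Rightarrow> \<mu>(v \<mapsto> t))"

text \<open>\<open>FEq x \<alpha>\<close> covers both \<open>?x = c\<close> (with \<open>c\<close> a URI or a literal) and \<open>?x = ?y\<close>.\<close>

datatype ('u, 'l, 'v) filter_cond =
    FBound 'v
  | FEq 'v "('u, 'l, 'v) pterm"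
  | FNot "('u, 'l, 'v) filter_cond"
  | FAnd "('u, 'l, 'v) filter_cond" "('u, 'l, 'v) filter_cond"
  | FOr "('u, 'l, 'v) filter_cond" "('u, 'l, 'v) filter_cond"

primrec satisfies ::
    "('u, 'b, 'l, 'v) mapping \<Rightarrow> ('u, 'l, 'v) filter_cond \<Rightarrow> bool" where
  "satisfies \<mu> (FBound x) \<longleftrightarrow> x \<in> dom \<mu>"
| "satisfies \<mu> (FEq x a) \<longleftrightarrow> (\<exists>t. \<mu> x = Some t \<and> inst \<mu> a = Some t)"
| "satisfies \<mu> (FNot R) \<longleftrightarrow> \<not> satisfies \<mu> R"
| "satisfies \<mu> (FAnd R1 R2) \<longleftrightarrow> satisfies \<mu> R1 \<and> satisfies \<mu> R2"
| "satisfies \<mu> (FOr R1 R2) \<longleftrightarrow> satisfies \<mu> R1 \<or> satisfies \<mu> R2"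

primrec filter_vars :: "('u, 'l, 'v) filter_cond \<Rightarrow> 'v set" where
  "filter_vars (FBound x) = {x}"
| "filter_vars (FEq x a) = {x} \<union> pterm_vars a"
| "filter_vars (FNot R) = filter_vars R"
| "filter_vars (FAnd R1 R2) = filter_vars R1 \<union> filter_vars R2"
| "filter_vars (FOr R1 R2) = filter_vars R1 \<union> filter_vars R2"

datatype ('u, 'l, 'v) graph_pattern =
    BGP "('u, 'l, 'v) triple_pattern set"
  | GAnd "('u, 'l, 'v) graph_pattern" "('u, 'l, 'v) graph_pattern"
  | GUnion "('u, 'l, 'v) graph_pattern" "('u, 'l, 'v) graph_pattern"
  | GOpt "('u, 'l, 'v) graph_pattern" "('u, 'l, 'v) graph_pattern"
  | GFilter "('u, 'l, 'v) graph_pattern" "('u, 'l, 'v) filter_cond"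
  | GGraphUri 'u "('u, 'l, 'v) graph_pattern"
  | GGraphVar 'v "('u, 'l, 'v) graph_pattern"
  | GBind "('u, 'l, 'v) graph_pattern" "('u, 'l, 'v) pterm" 'v

primrec gp_vars :: "('u, 'l, 'v) graph_pattern \<Rightarrow> 'v set" where
  "gp_vars (BGP B) = (\<Union>tp\<in>B. tp_vars tp)"
| "gp_vars (GAnd P1 P2) = gp_vars P1 \<union> gp_vars P2"
| "gp_vars (GUnion P1 P2) = gp_vars P1 \<union> gp_vars P2"
| "gp_vars (GOpt P1 P2) = gp_vars P1 \<union> gp_vars P2"
| "gp_vars (GFilter P R) = gp_vars P \<union> filter_vars R"
| "gp_vars (GGraphUri u P) = gp_vars P"
| "gp_vars (GGraphVar x P) = insert x (gp_vars P)"
| "gp_vars (GBind P e v) = insert v (gp_vars P \<union> pterm_vars e)"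

primrec wf_gp :: "('u, 'l, 'v) graph_pattern \<Rightarrow> bool" where
  "wf_gp (BGP B) \<longleftrightarrow> finite B \<and> (\<forall>(a, p, b) \<in> B. p \<notin> range PLit)"
| "wf_gp (GAnd P1 P2) \<longleftrightarrow> wf_gp P1 \<and> wf_gp P2"
| "wf_gp (GUnion P1 P2) \<longleftrightarrow> wf_gp P1 \<and> wf_gp P2"
| "wf_gp (GOpt P1 P2) \<longleftrightarrow> wf_gp P1 \<and> wf_gp P2"
| "wf_gp (GFilter P R) \<longleftrightarrow> wf_gp P"
| "wf_gp (GGraphUri u P) \<longleftrightarrow> wf_gp P"
| "wf_gp (GGraphVar x P) \<longleftrightarrow> wf_gp P"
| "wf_gp (GBind P e v) \<longleftrightarrow> wf_gp P \<and> v \<notin> gp_vars P"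

record ('u, 'b, 'l) dataset =
  default_graph :: "('u, 'b, 'l) triple set"
  named_graphs :: "'u \<rightharpoonup> ('u, 'b, 'l) triple set"

primrec eval_gp ::
    "('u, 'b, 'l) dataset \<Rightarrow> ('u, 'l, 'v) graph_pattern \<Rightarrow> ('u, 'b, 'l) triple set
      \<Rightarrow> ('u, 'b, 'l, 'v) mapping set" where
  "eval_gp DS (BGP B) G = {\<mu>. dom \<mu> = (\<Union>tp\<in>B. tp_vars tp) \<and> (\<forall>tp\<in>B. inst_in \<mu> tp G)}"
| "eval_gp DS (GAnd P1 P2) G = join (eval_gp DS P1 G) (eval_gp DS P2 G)"
| "eval_gp DS (GUnion P1 P2) G = eval_gp DS P1 G \<union> eval_gp DS P2 G"
| "eval_gp DS (GOpt P1 P2) G = left_join (eval_gp DS P1 G) (eval_gp DS P2 G)"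
| "eval_gp DS (GFilter P R) G = {\<mu> \<in> eval_gp DS P G. satisfies \<mu> R}"
| "eval_gp DS (GGraphUri u P) G =
     eval_gp DS P (case named_graphs DS u of None \<Rightarrow> {} | Some Gu \<Rightarrow> Gu)"
| "eval_gp DS (GGraphVar x P) G =
     (\<Union>u \<in> dom (named_graphs DS).
        join (eval_gp DS P (the (named_graphs DS u))) {[x \<mapsto> Uri u]})"
| "eval_gp DS (GBind P e v) G = bind_ext e v ` eval_gp DS P G"

text \<open>\<open>LWild\<close> is the symbol \<open>_\<close> and \<open>LCtxt\<close> is the symbol \<open>+\<close> of link patterns.\<close>

datatype ('u, 'l) lp_comp = LUri 'u | LLit 'l | LWild | LCtxt

type_synonym ('u, 'l) link_pattern = "('u, 'l) lp_comp \<times> ('u, 'l) lp_comp \<times> ('u, 'l) lp_comp"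

fun wf_lp :: "('u, 'l) link_pattern \<Rightarrow> bool" where
  "wf_lp (y1, y2, y3) \<longleftrightarrow> y1 \<notin> range LLit \<and> y2 \<notin> range LLit"

fun comp_matches :: "'u \<Rightarrow> ('u, 'b, 'l) rdf_term \<Rightarrow> ('u, 'l) lp_comp \<Rightarrow> bool" where
  "comp_matches uc x (LUri u) \<longleftrightarrow> x = Uri u"
| "comp_matches uc x (LLit l) \<longleftrightarrow> x = Lit l"
| "comp_matches uc x LWild \<longleftrightarrow> True"
| "comp_matches uc x LCtxt \<longleftrightarrow> x = Uri uc"

fun edge_matches ::
    "'u \<Rightarrow> ('u, 'b, 'l) triple \<times> 'u \<Rightarrow> ('u, 'l) link_pattern \<Rightarrow> bool" where
  "edge_matches uc ((x1, x2, x3), u) (y1, y2, y3) \<longleftrightarrow>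
     (y1 = LWild \<and> x1 = Uri u \<or> y2 = LWild \<and> x2 = Uri u \<or> y3 = LWild \<and> x3 = Uri u) \<and>
     comp_matches uc x1 y1 \<and> comp_matches uc x2 y2 \<and> comp_matches uc x3 y3"

datatype ('u, 'l, 'v) ldql =
    QBasic "('u, 'l, 'v) lpe" "('u, 'l, 'v) graph_pattern"
  | QSeed "'u set" "('u, 'l, 'v) ldql"
  | QSeedVar 'v "('u, 'l, 'v) ldql"
  | QAnd "('u, 'l, 'v) ldql" "('u, 'l, 'v) ldql"
  | QUnion "('u, 'l, 'v) ldql" "('u, 'l, 'v) ldql"
  | QProj "'v set" "('u, 'l, 'v) ldql"
and ('u, 'l, 'v) lpe =
    LEps
  | LLink "('u, 'l) link_pattern"
  | LSeq "('u, 'l, 'v) lpe" "('u, 'l, 'v) lpe"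
  | LAlt "('u, 'l, 'v) lpe" "('u, 'l, 'v) lpe"
  | LStar "('u, 'l, 'v) lpe"
  | LTest "('u, 'l, 'v) lpe"
  | LQuery 'v "('u, 'l, 'v) ldql"

primrec wf_ldql :: "('u, 'l, 'v) ldql \<Rightarrow> bool" and wf_lpe :: "('u, 'l, 'v) lpe \<Rightarrow> bool" where
  "wf_ldql (QBasic l P) \<longleftrightarrow> wf_lpe l \<and> wf_gp P"
| "wf_ldql (QSeed U q) \<longleftrightarrow> finite U \<and> wf_ldql q"
| "wf_ldql (QSeedVar v q) \<longleftrightarrow> wf_ldql q"
| "wf_ldql (QAnd q1 q2) \<longleftrightarrow> wf_ldql q1 \<and> wf_ldql q2"
| "wf_ldql (QUnion q1 q2) \<longleftrightarrow> wf_ldql q1 \<and> wf_ldql q2"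
| "wf_ldql (QProj V q) \<longleftrightarrow> finite V \<and> wf_ldql q"
| "wf_lpe LEps \<longleftrightarrow> True"
| "wf_lpe (LLink lp) \<longleftrightarrow> wf_lp lp"
| "wf_lpe (LSeq l1 l2) \<longleftrightarrow> wf_lpe l1 \<and> wf_lpe l2"
| "wf_lpe (LAlt l1 l2) \<longleftrightarrow> wf_lpe l1 \<and> wf_lpe l2"
| "wf_lpe (LStar l) \<longleftrightarrow> wf_lpe l"
| "wf_lpe (LTest l) \<longleftrightarrow> wf_lpe l"
| "wf_lpe (LQuery v q) \<longleftrightarrow> wf_ldql q"

definition dataset_of :: "('u, 'b, 'l, 'd) web \<Rightarrow> 'u set \<Rightarrow> ('u, 'b, 'l) dataset" where
  "dataset_of W U =
     \<lparr> default_graph = (\<Union>u \<in> U \<inter> dom (adoc W). data W (the (adoc W u))),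
       named_graphs = (\<lambda>u. if u \<in> U then map_option (data W) (adoc W u) else None) \<rparr>"

text \<open>\<open>lpe_pow f n\<close> is the semantics of \<open>l/\<dots>/l\<close> with \<open>n + 1\<close> occurrences of \<open>l\<close>, where \<open>f\<close> is that
  of \<open>l\<close>.\<close>

primrec lpe_pow :: "('u \<Rightarrow> 'u set) \<Rightarrow> nat \<Rightarrow> 'u \<Rightarrow> 'u set" where
  "lpe_pow f 0 u = f u"
| "lpe_pow f (Suc n) u = (\<Union>u' \<in> f u. lpe_pow f n u')"

text \<open>\<open>guard W uc X\<close> expresses that every LPE evaluates to the empty set in the context of a URI
  outside the domain of \<open>adoc\<close>.\<close>

definition guard :: "('u, 'b, 'l, 'd) web \<Rightarrow> 'u \<Rightarrow> 'a set \<Rightarrow> 'a set" where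
  "guard W uc X = (if uc \<in> dom (adoc W) then X else {})"

primrec
  eval_ldql ::
    "('u, 'b, 'l, 'd) web \<Rightarrow> ('u, 'l, 'v) ldql \<Rightarrow> 'u set \<Rightarrow> ('u, 'b, 'l, 'v) mapping set" and
  eval_lpe ::
    "('u, 'b, 'l, 'd) web \<Rightarrow> ('u, 'l, 'v) lpe \<Rightarrow> 'u \<Rightarrow> 'u set" where
  "eval_ldql W (QBasic l P) S =
     (let DS = dataset_of W (\<Union>u\<in>S. eval_lpe W l u) in eval_gp DS P (default_graph DS))"
| "eval_ldql W (QSeed U q) S = eval_ldql W q U"
| "eval_ldql W (QSeedVar v q) S = (\<Union>u. join (eval_ldql W q {u}) {[v \<mapsto> Uri u]})"
| "eval_ldql W (QAnd q1 q2) S = join (eval_ldql W q1 S) (eval_ldql W q2 S)"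
| "eval_ldql W (QUnion q1 q2) S = eval_ldql W q1 S \<union> eval_ldql W q2 S"
| "eval_ldql W (QProj V q) S = proj V (eval_ldql W q S)"
| "eval_lpe W LEps uc = guard W uc {uc}"
| "eval_lpe W (LLink lp) uc =
     guard W uc {u. \<exists>t d'. (the (adoc W uc), (t, u), d') \<in> link_graph W \<and> edge_matches uc (t, u) lp}"
| "eval_lpe W (LSeq l1 l2) uc = guard W uc (\<Union>u' \<in> eval_lpe W l1 uc. eval_lpe W l2 u')"
| "eval_lpe W (LAlt l1 l2) uc = guard W uc (eval_lpe W l1 uc \<union> eval_lpe W l2 uc)"
| "eval_lpe W (LStar l) uc = guard W uc ({uc} \<union> (\<Union>n. lpe_pow (eval_lpe W l) n uc))"
| "eval_lpe W (LTest l) uc = guard W uc (if eval_lpe W l uc \<noteq> {} then {uc} else {})"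
| "eval_lpe W (LQuery v q) uc = guard W uc {u. \<exists>\<mu> \<in> eval_ldql W q {uc}. \<mu> v = Some (Uri u)}"

datatype 'u pp_expr =
    PPLink 'u
  | PPNeg "'u list"
  | PPSeq "'u pp_expr" "'u pp_expr"
  | PPAlt "'u pp_expr" "'u pp_expr"
  | PPStar "'u pp_expr"

primrec wf_pp_expr :: "'u pp_expr \<Rightarrow> bool" where
  "wf_pp_expr (PPLink p) \<longleftrightarrow> True"
| "wf_pp_expr (PPNeg us) \<longleftrightarrow> us \<noteq> []"
| "wf_pp_expr (PPSeq e1 e2) \<longleftrightarrow> wf_pp_expr e1 \<and> wf_pp_expr e2"
| "wf_pp_expr (PPAlt e1 e2) \<longleftrightarrow> wf_pp_expr e1 \<and> wf_pp_expr e2"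
| "wf_pp_expr (PPStar e) \<longleftrightarrow> wf_pp_expr e"

definition ctxt_data ::
    "('u, 'b, 'l, 'd) web \<Rightarrow> ('u, 'b, 'l) rdf_term \<Rightarrow> ('u, 'b, 'l) triple set" where
  "ctxt_data W a =
     {(s, p, o'). \<exists>u d. a = Uri u \<and> adoc W u = Some d \<and> (s, p, o') \<in> data W d \<and> s = Uri u}"

definition eval_link ::
    "('u, 'b, 'l, 'd) web \<Rightarrow> 'u \<Rightarrow> ('u, 'l, 'v) pterm \<Rightarrow> ('u, 'l, 'v) pterm
      \<Rightarrow> ('u, 'b, 'l, 'v) mapping set" where
  "eval_link W p \<alpha> \<beta> =
     {\<mu>. dom \<mu> = pterm_vars \<alpha> \<union> pterm_vars \<beta> \<and>
         (\<exists>a. inst \<mu> \<alpha> = Some a \<and> inst_in \<mu> (\<alpha>, PUri p, \<beta>) (ctxt_data W a))}"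

text \<open>
  \<open>path_seq\<close> is the semantics of \<open>pe\<^sub>1/pe\<^sub>2\<close> in terms of those of \<open>pe\<^sub>1\<close> and \<open>pe\<^sub>2\<close>. Property path
  expressions contain no variables, so \<open>?v\<close> only needs to differ from \<open>\<alpha>\<close> and \<open>\<beta>\<close>.
\<close>

definition path_seq ::
    "(('u, 'l, 'v) pterm \<Rightarrow> ('u, 'l, 'v) pterm \<Rightarrow> ('u, 'b, 'l, 'v) mapping set) \<Rightarrow>
     (('u, 'l, 'v) pterm \<Rightarrow> ('u, 'l, 'v) pterm \<Rightarrow> ('u, 'b, 'l, 'v) mapping set) \<Rightarrow>
     ('u, 'l, 'v) pterm \<Rightarrow> ('u, 'l, 'v) pterm \<Rightarrow> ('u, 'b, 'l, 'v) mapping set" where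
  "path_seq f g \<alpha> \<beta> =
     (let v = (SOME v. v \<notin> pterm_vars \<alpha> \<union> pterm_vars \<beta>)
      in proj (pterm_vars \<alpha> \<union> pterm_vars \<beta>) (join (f \<alpha> (PVar v)) (g (PVar v) \<beta>)))"

text \<open>\<open>path_pow f n\<close> is the semantics of \<open>pe/\<dots>/pe\<close> with \<open>n + 1\<close> occurrences of \<open>pe\<close>.\<close>

primrec path_pow ::
    "(('u, 'l, 'v) pterm \<Rightarrow> ('u, 'l, 'v) pterm \<Rightarrow> ('u, 'b, 'l, 'v) mapping set) \<Rightarrow> nat \<Rightarrow>
     ('u, 'l, 'v) pterm \<Rightarrow> ('u, 'l, 'v) pterm \<Rightarrow> ('u, 'b, 'l, 'v) mapping set" where
  "path_pow f 0 = f"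
| "path_pow f (Suc n) = path_seq f (path_pow f n)"

primrec eval_path ::
    "('u, 'b, 'l, 'd) web \<Rightarrow> 'u pp_expr \<Rightarrow> ('u, 'l, 'v) pterm \<Rightarrow> ('u, 'l, 'v) pterm
      \<Rightarrow> ('u, 'b, 'l, 'v) mapping set" where
  "eval_path W (PPLink p) = eval_link W p"
| "eval_path W (PPNeg us) = (\<lambda>\<alpha> \<beta>. \<Union>p \<in> - set us. eval_link W p \<alpha> \<beta>)"
| "eval_path W (PPSeq e1 e2) = path_seq (eval_path W e1) (eval_path W e2)"
| "eval_path W (PPAlt e1 e2) = (\<lambda>\<alpha> \<beta>. eval_path W e1 \<alpha> \<beta> \<union> eval_path W e2 \<alpha> \<beta>)"
| "eval_path W (PPStar e) = (\<lambda>\<alpha> \<beta>.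
     {\<mu>. dom \<mu> = pterm_vars \<alpha> \<union> pterm_vars \<beta> \<and>
         (\<exists>t \<in> terms W. inst \<mu> \<alpha> = Some t \<and> inst \<mu> \<beta> = Some t)} \<union>
     (\<Union>n. path_pow (eval_path W e) n \<alpha> \<beta>))"

datatype ('u, 'l, 'v) pp_query =
    PPPattern "('u, 'l, 'v) pterm" "'u pp_expr" "('u, 'l, 'v) pterm"
  | PPAnd "('u, 'l, 'v) pp_query" "('u, 'l, 'v) pp_query"
  | PPUnion "('u, 'l, 'v) pp_query" "('u, 'l, 'v) pp_query"
  | PPOpt "('u, 'l, 'v) pp_query" "('u, 'l, 'v) pp_query"
  | PPFilter "('u, 'l, 'v) pp_query" "('u, 'l, 'v) filter_cond"
  | PPBind "('u, 'l, 'v) pp_query" "('u, 'l, 'v) pterm" 'v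

primrec pp_vars :: "('u, 'l, 'v) pp_query \<Rightarrow> 'v set" where
  "pp_vars (PPPattern \<alpha> e \<beta>) = pterm_vars \<alpha> \<union> pterm_vars \<beta>"
| "pp_vars (PPAnd R1 R2) = pp_vars R1 \<union> pp_vars R2"
| "pp_vars (PPUnion R1 R2) = pp_vars R1 \<union> pp_vars R2"
| "pp_vars (PPOpt R1 R2) = pp_vars R1 \<union> pp_vars R2"
| "pp_vars (PPFilter R C) = pp_vars R \<union> filter_vars C"
| "pp_vars (PPBind R e v) = insert v (pp_vars R \<union> pterm_vars e)"

primrec wf_pp_query :: "('u, 'l, 'v) pp_query \<Rightarrow> bool" where
  "wf_pp_query (PPPattern \<alpha> e \<beta>) \<longleftrightarrow> wf_pp_expr e"
| "wf_pp_query (PPAnd R1 R2) \<longleftrightarrow> wf_pp_query R1 \<and> wf_pp_query R2"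
| "wf_pp_query (PPUnion R1 R2) \<longleftrightarrow> wf_pp_query R1 \<and> wf_pp_query R2"
| "wf_pp_query (PPOpt R1 R2) \<longleftrightarrow> wf_pp_query R1 \<and> wf_pp_query R2"
| "wf_pp_query (PPFilter R C) \<longleftrightarrow> wf_pp_query R"
| "wf_pp_query (PPBind R e v) \<longleftrightarrow> wf_pp_query R \<and> v \<notin> pp_vars R"

primrec eval_ctxt ::
    "('u, 'b, 'l, 'd) web \<Rightarrow> ('u, 'l, 'v) pp_query \<Rightarrow> ('u, 'b, 'l, 'v) mapping set" where
  "eval_ctxt W (PPPattern \<alpha> e \<beta>) = eval_path W e \<alpha> \<beta>"
| "eval_ctxt W (PPAnd R1 R2) = join (eval_ctxt W R1) (eval_ctxt W R2)"
| "eval_ctxt W (PPUnion R1 R2) = eval_ctxt W R1 \<union> eval_ctxt W R2"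
| "eval_ctxt W (PPOpt R1 R2) = left_join (eval_ctxt W R1) (eval_ctxt W R2)"
| "eval_ctxt W (PPFilter R C) = {\<mu> \<in> eval_ctxt W R. satisfies \<mu> C}"
| "eval_ctxt W (PPBind R e v) = bind_ext e v ` eval_ctxt W R"

end

(* The context-based semantics sees a triple only in a document looked up by the subject of that
   triple, apart from the set of all terms of the Web, which enters through the zero-length paths
   of star expressions. So it cannot distinguish two Webs that have the same terms and in which no
   such triple exists, whereas an LDQL query can read the content of a seed document. *)

theory Submission
  imports Defs
begin

lemma eval_link_cong:
  assumes "ctxt_data W = ctxt_data W'"
  shows "eval_link W = eval_link W'"
  using assms by (intro ext) (simp add: eval_link_def)

text \<open>The equation is between functions of both endpoints, so the induction hypothesis
  rewrites inside \<open>path_seq\<close> and \<open>path_pow\<close>, where fresh variables become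
  endpoints.\<close>

lemma eval_path_cong:
  assumes "ctxt_data W = ctxt_data W'" and "terms W = terms W'"
  shows "eval_path W e = eval_path W' e"
  by (induction e) (simp_all add: assms eval_link_cong[OF assms(1)])

lemma eval_ctxt_cong:
  assumes "ctxt_data W = ctxt_data W'" and "terms W = terms W'"
  shows "eval_ctxt W R = eval_ctxt W' R"
  by (induction R) (simp_all add: eval_path_cong[OF assms])

text \<open>All documents other than \<open>d\<close> are empty, which makes the disjointness of
  blank nodes automatic.\<close>

definition single_doc_web ::
    "'u \<Rightarrow> 'd \<Rightarrow> ('u, 'b, 'l) triple set \<Rightarrow> ('u, 'b, 'l, 'd) web" where
  "single_doc_web u d G = \<lparr>docs = {d}, adoc = [u \<mapsto> d], data = (\<lambda>_. {})(d := G)\<rparr>"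

lemma is_web_single_doc_web:
  assumes "finite G" and "G \<subseteq> rdf_triples"
  shows "is_web (single_doc_web u d G)"
  using assms by (auto simp: is_web_def single_doc_web_def blanks_def)

lemma terms_single_doc_web: "terms (single_doc_web u d G) = \<Union> (triple_terms ` G)"
  by (simp add: terms_def single_doc_web_def)

lemma ctxt_data_single_doc_web:
  assumes "\<And>p o'. (Uri u, p, o') \<notin> G"
  shows "ctxt_data (single_doc_web u d G) = (\<lambda>_. {})"
  using assms by (intro ext) (auto simp: ctxt_data_def single_doc_web_def split: if_splits)

text \<open>\<open>QSeed\<close> discards \<open>S\<close> and \<open>LEps\<close> stays at
  \<open>u\<close>, so the pattern sees exactly \<open>G\<close>.\<close>

lemma eval_seed_single_doc_web:
  "eval_ldql (single_doc_web u d G) (QSeed {u} (QBasic LEps P)) S =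
     eval_gp \<lparr>default_graph = G, named_graphs = [u \<mapsto> G]\<rparr> P G"
proof -
  have "dataset_of (single_doc_web u d G) {u} =
      \<lparr>default_graph = G, named_graphs = [u \<mapsto> G]\<rparr>"
    by (auto simp: dataset_of_def single_doc_web_def)
  moreover have "eval_lpe (single_doc_web u d G) LEps u = {u}"
    by (simp add: guard_def single_doc_web_def)
  ultimately show ?thesis
    by simp
qed

theorem theorem1:
  shows "\<exists>q :: ('u::infinite, 'l::infinite, 'v::infinite) ldql. wf_ldql q \<and>
    \<not> (\<exists>(R :: ('u, 'l, 'v) pp_query) (S :: 'u set). wf_pp_query R \<and> finite S \<and>
          (\<forall>W :: ('u, 'b::infinite, 'l, 'd::infinite) web.
             is_web W \<longrightarrow> eval_ctxt W R = eval_ldql W q S))"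
proof -
  obtain u a :: 'u where "a \<noteq> u"
    using ex_new_if_finite[OF infinite_UNIV, of "{undefined :: 'u}"] by auto
  define q :: "('u, 'l, 'v) ldql" where
    "q = QSeed {u} (QBasic LEps (BGP {(PUri a, PUri a, PUri u)}))"
  \<comment> \<open>Both triples have the terms \<open>a\<close> and \<open>u\<close>. Their subject
    \<open>a\<close> differs from \<open>u\<close>, the only URI with a document, so no context
    contains them.\<close>
  define W W' :: "('u, 'b, 'l, 'd) web" where
    "W = single_doc_web u undefined {(Uri a, Uri a, Uri u)}" and
    "W' = single_doc_web u undefined {(Uri a, Uri u, Uri a)}"
  have webs: "is_web W" "is_web W'"
    unfolding W_def W'_def by (auto intro!: is_web_single_doc_web simp: rdf_triples_def)
  have "ctxt_data W = ctxt_data W'"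
    using \<open>a \<noteq> u\<close> unfolding W_def W'_def by (simp add: ctxt_data_single_doc_web)
  moreover have "terms W = terms W'"
    unfolding W_def W'_def terms_single_doc_web by auto
  ultimately have same: "eval_ctxt W R = eval_ctxt W' R" for R :: "('u, 'l, 'v) pp_query"
    by (rule eval_ctxt_cong)
  \<comment> \<open>The pattern of \<open>q\<close> has no variables: the empty mapping is a
    solution iff the triple of \<open>W\<close> is present.\<close>
  have "Map.empty \<in> eval_ldql W q S" "Map.empty \<notin> eval_ldql W' q S" for S
    using \<open>a \<noteq> u\<close> unfolding q_def W_def W'_def eval_seed_single_doc_web by auto
  then have "eval_ldql W q S \<noteq> eval_ldql W' q S" for S
    by blast
  moreover have "wf_ldql q"
    by (auto simp: q_def)
  ultimately show ?thesis
    using webs same by metis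
qed

end
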